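(* Let $\beta=2$. For all $x,y\in\mathbb D$, under nearest rounding, define $$z=fl(x+y),\quad w=fl(z-x),\quad z1=fl(y-w),\quad v=fl(w-z),\quad z2=fl(x+v),\quad zz=fl(z1+z2).$$ Then $z+zz=x+y$ exactly (in $\mathbb R$).
   Context: Dekker's floating point number system: let $\beta>1$, $t\ge 1$, $E_{\min}\le E_{\max}$ be integers and $M=\beta^t$. Then $\mathbb D=\{x\in\mathbb R : x=m(x)\times\beta^{e(x)},\ m(x)\in\mathbb Z,\ |m(x)|<M,\ e(x)\in\mathbb Z,\ E_{\min}\le e(x)\le E_{\max}\}$. Nearest rounding: $fl:\mathbb R\to\mathbb D$ satisfies $|fl(r)-r|\le|a-r|$ for all $a\in\mathbb D$, with ties resolved by a fixed deterministic tie-breaking criterion depending on the input only. In particular, a real number $r$ with $|r|>(M-1)\times\beta^{E_{\max}}$ (overflow) is mapped to $\pm(M-1)\times\beta^{E_{\max}}$ according to its sign. "As if" rule: each floating point operation is performed as if the exact real result is produced first and then rounded by $fl$; the expressions inside $fl(\cdot)$ are thus exact real sums and differences. The symbols $z1$, $z2$, $zz$ are names of single variables. *)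

theory Defs
  imports Complex_Main
begin

(* Floats are identified with their real values, so one float may have several
   representations (m, e); nothing forces m to be normalized.  The exponent e may be
   negative, hence powi. *)
definition dekker_floats :: "int \<Rightarrow> nat \<Rightarrow> int \<Rightarrow> int \<Rightarrow> real set" where
  "dekker_floats \<beta> t Emin Emax =
     {x. \<exists>m e :: int. x = of_int m * of_int \<beta> powi e \<and> \<bar>m\<bar> < \<beta> ^ t \<and> Emin \<le> e \<and> e \<le> Emax}"

(* The tie-breaking criterion is arbitrary, but fixed and dependent on the input only,
   because fl is a function.  Overflow needs no separate clause: see
   nearest_rounding_overflow below. *)
definition nearest_rounding :: "real set \<Rightarrow> (real \<Rightarrow> real) \<Rightarrow> bool" where
  "nearest_rounding D fl \<longleftrightarrow>
     (\<forall>r. fl r \<in> D \<and> (\<forall>a\<in>D. \<bar>fl r - r\<bar> \<le> \<bar>a - r\<bar>))"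

lemma dekker_floats_abs_le:
  assumes "\<beta> > 1" "x \<in> dekker_floats \<beta> t Emin Emax"
  shows "\<bar>x\<bar> \<le> of_int (\<beta> ^ t - 1) * of_int \<beta> powi Emax"
proof -
  obtain m e :: int where x: "x = of_int m * of_int \<beta> powi e"
    and m: "\<bar>m\<bar> < \<beta> ^ t" and e: "e \<le> Emax"
    using assms(2) by (auto simp: dekker_floats_def)
  have b: "(1::real) \<le> of_int \<beta>" using assms(1) by simp
  have p: "(of_int \<beta> :: real) powi e \<le> of_int \<beta> powi Emax"
    using e b by (rule power_int_increasing)
  have q: "0 \<le> (of_int \<beta> :: real) powi e" using b by simp
  have "\<bar>m\<bar> \<le> \<beta> ^ t - 1" using m by simp
  then have "(of_int \<bar>m\<bar> :: real) \<le> of_int (\<beta> ^ t - 1)" by (simp only: of_int_le_iff)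
  moreover have "\<bar>x\<bar> = of_int \<bar>m\<bar> * of_int \<beta> powi e" using q by (simp add: x abs_mult)
  moreover have "(0::real) \<le> of_int (\<beta> ^ t - 1)" using b by simp
  ultimately show ?thesis using p q by (metis mult_mono)
qed

lemma nearest_rounding_overflow:
  assumes "\<beta> > 1" "Emin \<le> Emax"
    and "nearest_rounding (dekker_floats \<beta> t Emin Emax) fl"
    and "\<bar>r\<bar> > of_int (\<beta> ^ t - 1) * of_int \<beta> powi Emax"
  shows "fl r = sgn r * (of_int (\<beta> ^ t - 1) * of_int \<beta> powi Emax)"
proof -
  define B :: real where "B = of_int (\<beta> ^ t - 1) * of_int \<beta> powi Emax"
  have pos: "\<beta> ^ t \<ge> 1" using assms(1) by simp
  have in1: "B \<in> dekker_floats \<beta> t Emin Emax"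
    unfolding dekker_floats_def mem_Collect_eq B_def
    by (rule exI[of _ "\<beta> ^ t - 1"], rule exI[of _ Emax]) (use pos assms(2) in simp)
  have in2: "- B \<in> dekker_floats \<beta> t Emin Emax"
    unfolding dekker_floats_def mem_Collect_eq B_def
    by (rule exI[of _ "1 - \<beta> ^ t"], rule exI[of _ Emax])
      (use pos assms(2) in \<open>simp add: algebra_simps\<close>)
  have "\<bar>fl r\<bar> \<le> B" "\<bar>fl r - r\<bar> \<le> \<bar>B - r\<bar>" "\<bar>fl r - r\<bar> \<le> \<bar>- B - r\<bar>"
    using assms(3) in1 in2 dekker_floats_abs_le[OF assms(1)]
    unfolding nearest_rounding_def B_def by blast+
  moreover have "\<bar>r\<bar> > B" using assms(4) by (simp add: B_def)
  ultimately show ?thesis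
    unfolding B_def[symmetric] by (cases "r > 0"; cases "r < 0"; simp add: sgn_if)
qed

end

theory Submission
  imports Defs
begin

text \<open>Dividing by \<open>2 powi Emin\<close> turns the floats into integers. The key fact is that if \<open>x\<close> is
  a float and \<open>y\<close> is a float on a grid that also contains \<open>x\<close>, then \<open>fl (x + y) - x\<close> is a float,
  and so is the rounding error \<open>x + y - fl (x + y)\<close>. If \<open>y\<close> has the finer grid, \<open>w = z - x\<close> is
  exact and everything collapses. If \<open>x\<close> has the finer grid, \<open>w\<close> may be inexact; but it is the
  rounded sum both of \<open>z\<close> and \<open>- x\<close> and of \<open>y\<close> and \<open>- r\<close>, where \<open>r = x + y - z\<close>,
  so the key fact makes \<open>w - z\<close> and \<open>w - y\<close> floats and all later operations are exact.\<close>

section \<open>Floats scaled to integers\<close>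

text \<open>Exponents are counted from \<open>Emin\<close>, so \<open>E\<close> stands for
  \<open>Emax - Emin\<close>. The mantissa is hidden in the divisibility:
  \<open>k = m * 2 ^ e\<close> with \<open>m\<close> below \<open>2 ^ t\<close> in absolute
  value.\<close>

definition int_floats :: "nat \<Rightarrow> nat \<Rightarrow> int set" where
  "int_floats t E = {k. \<exists>e\<le>E. 2 ^ e dvd k \<and> \<bar>k\<bar> < 2 ^ (t + e)}"

text \<open>A relation rather than a function, so that either outcome of a tie is covered and
  negation preserves it, although \<open>fl\<close> need not be odd.\<close>

definition is_nearest :: "int set \<Rightarrow> int \<Rightarrow> int \<Rightarrow> bool" where
  "is_nearest F s a \<longleftrightarrow> a \<in> F \<and> (\<forall>b\<in>F. \<bar>a - s\<bar> \<le> \<bar>b - s\<bar>)"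

lemma int_floatsI: "e \<le> E \<Longrightarrow> 2 ^ e dvd k \<Longrightarrow> \<bar>k\<bar> < 2 ^ (t + e) \<Longrightarrow> k \<in> int_floats t E"
  by (auto simp: int_floats_def)

lemma int_floats_uminus_iff [simp]: "- k \<in> int_floats t E \<longleftrightarrow> k \<in> int_floats t E"
  by (simp add: int_floats_def)

lemma zero_in_int_floats [simp]: "0 \<in> int_floats t E"
  by (auto simp: int_floats_def)

text \<open>With exponent \<open>e\<close> the mantissa would be \<open>2 ^ t\<close>, just out of
  range; with exponent \<open>Suc e\<close> it is \<open>2 ^ (t - 1)\<close>.\<close>

lemma power_in_int_floats:
  assumes "t \<ge> 1" "e < E"
  shows "2 ^ (t + e) \<in> int_floats t E"
proof (rule int_floatsI[of "Suc e"])
  show "(2::int) ^ Suc e dvd 2 ^ (t + e)"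
    using assms(1) by (intro le_imp_power_dvd) simp
qed (use assms in auto)

text \<open>A representation with exponent above \<open>e\<close> would make \<open>k\<close> a
  multiple of \<open>2 ^ Suc e\<close>.\<close>

lemma int_floats_abs_less_if_not_dvd:
  assumes "k \<in> int_floats t E" "\<not> 2 ^ Suc e dvd k"
  shows "\<bar>k\<bar> < 2 ^ (t + e)"
proof -
  from assms(1) obtain e' where e': "2 ^ e' dvd k" "\<bar>k\<bar> < 2 ^ (t + e')"
    by (auto simp: int_floats_def)
  have "\<not> Suc e \<le> e'"
    using assms(2) e'(1) power_le_dvd by blast
  then have "(2::int) ^ (t + e') \<le> 2 ^ (t + e)"
    by (intro power_increasing) auto
  with e'(2) show ?thesis by linarith
qed

lemma int_floats_abs_less: "k \<in> int_floats t E \<Longrightarrow> \<bar>k\<bar> < 2 ^ (t + E)"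
proof -
  assume "k \<in> int_floats t E"
  then obtain e where e: "e \<le> E" "\<bar>k\<bar> < 2 ^ (t + e)"
    by (auto simp: int_floats_def)
  then have "(2::int) ^ (t + e) \<le> 2 ^ (t + E)"
    by (intro power_increasing) auto
  with e(2) show ?thesis by linarith
qed

section \<open>Nearest rounding on integers\<close>

lemma is_nearest_exact: "is_nearest F s a \<Longrightarrow> s \<in> F \<Longrightarrow> a = s"
  by (force simp: is_nearest_def)

lemma is_nearest_uminus:
  assumes "is_nearest (int_floats t E) s a"
  shows "is_nearest (int_floats t E) (- s) (- a)"
proof -
  have "\<bar>- a - - s\<bar> \<le> \<bar>b - - s\<bar>" if "b \<in> int_floats t E" for b
    using assms that int_floats_uminus_iff[of b t E]
    unfolding is_nearest_def by (smt (verit))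
  with assms show ?thesis by (simp add: is_nearest_def)
qed

lemma is_nearest_mono: "is_nearest F s a \<Longrightarrow> b \<in> F \<Longrightarrow> b \<le> s \<Longrightarrow> b \<le> a"
  by (force simp: is_nearest_def)

text \<open>A small \<open>s\<close> is itself a float. Otherwise \<open>a\<close> is at least as
  large in absolute value as the largest float of exponent \<open>e\<close>, which no float of
  smaller exponent reaches.\<close>

lemma is_nearest_dvd:
  assumes near: "is_nearest (int_floats t E) s a" and e: "e \<le> E" "2 ^ e dvd s"
  shows "2 ^ e dvd a"
proof (cases "\<bar>s\<bar> < 2 ^ (t + e)")
  case True
  then show ?thesis
    using is_nearest_exact[OF near] int_floatsI[OF e] e(2) by simp
next
  case False
  define B :: int where "B = 2 ^ (t + e) - 2 ^ e"
  have pos: "(0::int) < 2 ^ e" "(2::int) ^ e \<le> 2 ^ (t + e)"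
    by (auto intro: power_increasing)
  have B: "B \<in> int_floats t E"
  proof (rule int_floatsI[OF e(1)])
    show "2 ^ e dvd B" by (simp add: B_def power_add)
  qed (use pos in \<open>simp add: B_def\<close>)
  have "B \<le> s \<or> B \<le> - s"
    using False pos(1) unfolding B_def by linarith
  then have "B \<le> a \<or> B \<le> - a"
    using is_nearest_mono[OF near B] is_nearest_mono[OF is_nearest_uminus[OF near] B] by blast
  then have "B \<le> \<bar>a\<bar>" by linarith
  show ?thesis
  proof (rule ccontr)
    assume a: "\<not> 2 ^ e dvd a"
    have "a \<in> int_floats t E" using near by (simp add: is_nearest_def)
    then obtain d where d: "2 ^ d dvd a" "\<bar>a\<bar> < 2 ^ (t + d)"
      by (auto simp: int_floats_def)
    \<comment> \<open>A nonzero float excludes \<open>t = 0\<close>, which makes the factor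
      \<open>2 ^ t - 1\<close> below positive.\<close>
    have "a \<noteq> 0" using a by auto
    then have "2 ^ d \<le> \<bar>a\<bar>" using d(1) by (intro zdvd_imp_le) auto
    with d(2) have "t \<noteq> 0" by (intro notI) simp
    then have t: "(0::int) < 2 ^ t - 1" by simp
    have "d < e" using a d(1) power_le_dvd by (metis linorder_not_less)
    then have "(2::int) ^ d < 2 ^ e" by simp
    with t have "(2 ^ t - 1) * (2::int) ^ d < (2 ^ t - 1) * 2 ^ e"
      by (rule mult_strict_left_mono[rotated])
    moreover have "2 ^ d dvd 2 ^ (t + d) - \<bar>a\<bar>"
      using d(1) by (simp add: power_add)
    then have "2 ^ d \<le> 2 ^ (t + d) - \<bar>a\<bar>"
      using d(2) by (intro zdvd_imp_le) auto
    ultimately show False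
      using \<open>B \<le> \<bar>a\<bar>\<close> by (simp add: B_def power_add algebra_simps)
  qed
qed

section \<open>Rounding error of a sum and distance to an operand\<close>

text \<open>The float \<open>x\<close> competes with \<open>z\<close>, so the error is at most
  \<open>\<bar>y\<bar>\<close>; it also stays on the grid of \<open>2 ^ e\<close>.\<close>

lemma is_nearest_error_float:
  assumes near: "is_nearest (int_floats t E) (x + y) z" and x: "x \<in> int_floats t E"
    and e: "e \<le> E" "2 ^ e dvd x" "2 ^ e dvd y" and y: "\<bar>y\<bar> < 2 ^ (t + e)"
  shows "2 ^ e dvd x + y - z" "\<bar>x + y - z\<bar> < 2 ^ (t + e)" "x + y - z \<in> int_floats t E"
proof -
  show 1: "2 ^ e dvd x + y - z"
    using is_nearest_dvd[OF near e(1)] e(2,3) by simp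
  have "\<bar>z - (x + y)\<bar> \<le> \<bar>x - (x + y)\<bar>"
    using near x by (auto simp: is_nearest_def)
  with y show 2: "\<bar>x + y - z\<bar> < 2 ^ (t + e)" by linarith
  show "x + y - z \<in> int_floats t E"
    using int_floatsI[OF e(1) 1 2] .
qed

lemma is_nearest_diff_float_nonneg:
  assumes t: "t \<ge> 1" and near: "is_nearest (int_floats t E) (x + y) z" and x: "x \<in> int_floats t E"
    and e: "e \<le> E" "2 ^ e dvd x" "2 ^ e dvd y" and y: "\<bar>y\<bar> < 2 ^ (t + e)"
    and nonneg: "x + y \<ge> 0"
  shows "z - x \<in> int_floats t E"
proof -
  have z: "z \<in> int_floats t E" using near by (simp add: is_nearest_def)
  have z0: "z \<ge> 0" using is_nearest_mono[OF near] nonneg by simp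
  have dvd: "2 ^ e dvd z - x"
    using is_nearest_dvd[OF near e(1)] e(2,3) by simp
  have pos: "(0::int) < 2 ^ e" by simp
  consider "x + y < 2 ^ (t + e)" | "x + y \<ge> 2 ^ (t + e)" "e = E"
    | "x + y \<ge> 2 ^ (t + e)" "e < E" "2 ^ Suc e dvd x"
    | "x + y \<ge> 2 ^ (t + e)" "e < E" "\<not> 2 ^ Suc e dvd x"
    using e(1) by linarith
  then show ?thesis
  proof cases
    case 1
    then have "x + y \<in> int_floats t E"
      using e nonneg by (intro int_floatsI[of e]) auto
    then have "z - x = y" using is_nearest_exact[OF near] by simp
    then show ?thesis using int_floatsI[OF e(1,3) y] by simp
  next
    case 2
    \<comment> \<open>The bound on \<open>y\<close> forces \<open>x > 0\<close>, and two nonnegative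
      numbers below \<open>2 ^ (t + E)\<close> differ by less than that.\<close>
    then have "\<bar>z - x\<bar> < 2 ^ (t + e)"
      using int_floats_abs_less[OF x] int_floats_abs_less[OF z] y z0 by (auto simp: abs_if split: if_splits)
    then show ?thesis using int_floatsI[OF e(1) dvd] by simp
  next
    case 3
    have "2 ^ (t + e) \<le> z"
      using is_nearest_mono[OF near power_in_int_floats[OF t 3(2)] 3(1)] .
    then have "2 ^ Suc e dvd z"
      using int_floats_abs_less_if_not_dvd[OF z, of e] by fastforce
    then have "2 ^ Suc e dvd z - x" using 3(3) by (rule dvd_diff)
    moreover have "\<bar>z - (x + y)\<bar> \<le> \<bar>x - (x + y)\<bar>"
      using near x by (auto simp: is_nearest_def)
    \<comment> \<open>The error is at most \<open>\<bar>y\<bar>\<close>, hence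
      \<open>\<bar>z - x\<bar> \<le> 2 * \<bar>y\<bar>\<close>; the coarser grid makes up for the
      factor 2.\<close>
    with y have "\<bar>z - x\<bar> < 2 ^ (t + Suc e)" by simp
    ultimately show ?thesis using 3(2) int_floatsI[of "Suc e"] by simp
  next
    case 4
    have x': "\<bar>x\<bar> < 2 ^ (t + e)" using int_floats_abs_less_if_not_dvd[OF x 4(3)] .
    \<comment> \<open>Since \<open>x + y < 2 * 2 ^ (t + e)\<close>, whichever of
      \<open>x + y\<close> and \<open>x + y - 2 ^ e\<close> is a multiple of
      \<open>2 ^ Suc e\<close> is a float.\<close>
    have "\<bar>z - (x + y)\<bar> \<le> 2 ^ e"
    proof (cases "2 ^ Suc e dvd x + y")
      case True
      then have "x + y \<in> int_floats t E"
        using 4 x' y nonneg by (intro int_floatsI[of "Suc e"]) auto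
      then show ?thesis using is_nearest_exact[OF near] by simp
    next
      case False
      have "2 ^ e dvd x + y" using e by simp
      then obtain q where q: "x + y = 2 ^ e * q" by (auto elim: dvdE)
      with False have "odd q" by (metis mult.commute mult_dvd_mono dvd_refl power_Suc)
      then have "2 ^ e * 2 dvd 2 ^ e * (q - 1)" by (intro mult_dvd_mono) auto
      then have "2 ^ Suc e dvd x + y - 2 ^ e" using q by (simp add: algebra_simps)
      moreover have "(2::int) ^ e \<le> 2 ^ (t + e)" by (intro power_increasing) auto
      then have "\<bar>x + y - 2 ^ e\<bar> < 2 * 2 ^ (t + e)" using 4(1) x' y pos by linarith
      ultimately have "x + y - 2 ^ e \<in> int_floats t E"
        using 4(2) by (intro int_floatsI[of "Suc e"]) simp_all
      then have "\<bar>z - (x + y)\<bar> \<le> \<bar>x + y - 2 ^ e - (x + y)\<bar>"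
        using near unfolding is_nearest_def by blast
      then show ?thesis by simp
    qed
    \<comment> \<open>As a multiple of \<open>2 ^ e\<close>, \<open>y\<close> leaves exactly the
      room that the rounding error takes.\<close>
    moreover have "y \<le> 2 ^ (t + e) - 2 ^ e"
    proof -
      have "2 ^ e dvd 2 ^ (t + e) - y" using e(3) by (simp add: power_add)
      then have "2 ^ e \<le> 2 ^ (t + e) - y" using y by (intro zdvd_imp_le) auto
      then show ?thesis by simp
    qed
    moreover have "y > 0" using 4(1) x' by linarith
    moreover have "(2::int) ^ e \<le> 2 ^ (t + e)" by (intro power_increasing) auto
    ultimately have "\<bar>z - x\<bar> \<le> 2 ^ (t + e)" by linarith
    \<comment> \<open>The two boundary values need exponent \<open>Suc e\<close>, available because
      \<open>e < E\<close>.\<close>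
    then consider "\<bar>z - x\<bar> < 2 ^ (t + e)" | "z - x = 2 ^ (t + e)" | "z - x = - (2 ^ (t + e))"
      by linarith
    then show ?thesis
    proof cases
      case 1
      then show ?thesis using int_floatsI[OF e(1) dvd] by simp
    qed (simp_all add: power_in_int_floats[OF t 4(2)])
  qed
qed

lemma is_nearest_diff_float:
  assumes "t \<ge> 1" "is_nearest (int_floats t E) (x + y) z" "x \<in> int_floats t E"
    and "e \<le> E" "2 ^ e dvd x" "2 ^ e dvd y" "\<bar>y\<bar> < 2 ^ (t + e)"
  shows "z - x \<in> int_floats t E"
proof (cases "x + y \<ge> 0")
  case True
  then show ?thesis using is_nearest_diff_float_nonneg assms by blast
next
  case False
  have "- z - - x \<in> int_floats t E"
  proof (rule is_nearest_diff_float_nonneg[where y = "- y"])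
    show "is_nearest (int_floats t E) (- x + - y) (- z)"
      using is_nearest_uminus[OF assms(2)] by simp
  qed (use assms False in auto)
  then show ?thesis using int_floats_uminus_iff[of "z - x" t E] by simp
qed

section \<open>The algorithm on integers\<close>

lemma is_nearest_two_sum:
  assumes t: "t \<ge> 1" and x: "x \<in> int_floats t E" and y: "y \<in> int_floats t E"
    and z: "is_nearest (int_floats t E) (x + y) z"
    and w: "is_nearest (int_floats t E) (z - x) w"
    and z1: "is_nearest (int_floats t E) (y - w) z1"
    and v: "is_nearest (int_floats t E) (w - z) v"
    and z2: "is_nearest (int_floats t E) (x + v) z2"
    and zz: "is_nearest (int_floats t E) (z1 + z2) zz"
  shows "z + zz = x + y"
proof -
  let ?F = "int_floats t E"
  from x obtain ex where ex: "ex \<le> E" "2 ^ ex dvd x" "\<bar>x\<bar> < 2 ^ (t + ex)"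
    by (auto simp: int_floats_def)
  from y obtain ey where ey: "ey \<le> E" "2 ^ ey dvd y" "\<bar>y\<bar> < 2 ^ (t + ey)"
    by (auto simp: int_floats_def)
  \<comment> \<open>These memberships make every operation after \<open>w\<close> exact, and then
    \<open>z1 + z2\<close> telescopes to \<open>x + y - z\<close>.\<close>
  have "x + y - z \<in> ?F \<and> y - w \<in> ?F \<and> w - z \<in> ?F \<and> x + (w - z) \<in> ?F"
  proof (cases "ey \<le> ex")
    case True
    then have "2 ^ ey dvd x" using ex(2) power_le_dvd by blast
    then have "z - x \<in> ?F" and r: "x + y - z \<in> ?F"
      using is_nearest_diff_float[OF t z x] is_nearest_error_float(3)[OF z x] ey by blast+
    then have "w = z - x" using is_nearest_exact[OF w] by blast
    moreover from this have "y - w = x + y - z" "w - z = - x" by simp_all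
    ultimately show ?thesis using x r by (simp only:) simp
  next
    case False
    then have dy: "2 ^ ex dvd y" using ey(2) power_le_dvd by (metis nat_le_linear)
    have z': "is_nearest ?F (y + x) z" using z by (simp add: add.commute)
    note r = is_nearest_error_float[OF z' y ex(1) dy ex(2,3)]
    have zF: "z \<in> ?F" using z by (simp add: is_nearest_def)
    have dz: "2 ^ ex dvd z" using is_nearest_dvd[OF z ex(1)] ex(2) dy by simp
    \<comment> \<open>Two readings of \<open>z - x\<close>: the summands \<open>- x\<close> and
      \<open>- (y + x - z)\<close> both lie on the grid of \<open>2 ^ ex\<close> and below
      \<open>2 ^ (t + ex)\<close>, as the key fact asks.\<close>
    have w1: "is_nearest ?F (z + - x) w" using w by simp
    have w2: "is_nearest ?F (y + - (y + x - z)) w" using w by simp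
    have "w - z \<in> ?F"
      using is_nearest_diff_float[OF t w1 zF ex(1) dz] ex by simp
    moreover have "z + - x - w \<in> ?F"
      using is_nearest_error_float(3)[OF w1 zF ex(1) dz] ex by simp
    then have "x + (w - z) \<in> ?F"
      using int_floats_uminus_iff[of "z + - x - w" t E] by (simp add: algebra_simps)
    moreover have "w - y \<in> ?F"
      by (rule is_nearest_diff_float[OF t w2 y ex(1) dy]) (use r in \<open>simp_all add: abs_minus_commute dvd_diff_commute\<close>)
    then have "y - w \<in> ?F"
      using int_floats_uminus_iff[of "w - y" t E] by simp
    ultimately show ?thesis using r(3) by (simp add: add.commute)
  qed
  then have r: "x + y - z \<in> ?F" and "z1 = y - w" "v = w - z" "x + (w - z) \<in> ?F"
    using is_nearest_exact z1 v by blast+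
  moreover from this have "z2 = x + (w - z)" using is_nearest_exact z2 by blast
  ultimately have "z1 + z2 = x + y - z" by simp
  with r zz show ?thesis using is_nearest_exact[OF zz] by simp
qed

section \<open>Transfer to the reals\<close>

lemma dekker_floats_2_eq:
  assumes "Emin \<le> Emax"
  shows "dekker_floats 2 t Emin Emax =
    (\<lambda>k. of_int k * 2 powi Emin) ` int_floats t (nat (Emax - Emin))"
proof (intro equalityI subsetI)
  fix x assume "x \<in> dekker_floats 2 t Emin Emax"
  then obtain m e :: int where x: "x = of_int m * 2 powi e" and m: "\<bar>m\<bar> < 2 ^ t"
    and e: "Emin \<le> e" "e \<le> Emax"
    by (auto simp: dekker_floats_def)
  define d where "d = nat (e - Emin)"
  have "e = int d + Emin" using e by (simp add: d_def)
  then have "x = of_int (m * 2 ^ d) * 2 powi Emin"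
    by (simp add: x power_int_add)
  moreover have "m * 2 ^ d \<in> int_floats t (nat (Emax - Emin))"
    by (rule int_floatsI[of d]) (use e m in \<open>auto simp: d_def abs_mult power_add\<close>)
  ultimately show "x \<in> (\<lambda>k. of_int k * 2 powi Emin) ` int_floats t (nat (Emax - Emin))"
    by blast
next
  fix x :: real assume "x \<in> (\<lambda>k. of_int k * 2 powi Emin) ` int_floats t (nat (Emax - Emin))"
  then obtain k d where x: "x = of_int k * 2 powi Emin"
    and d: "d \<le> nat (Emax - Emin)" "2 ^ d dvd k" "\<bar>k\<bar> < 2 ^ (t + d)"
    by (auto simp: int_floats_def)
  from d(2) obtain m where k: "k = 2 ^ d * m" by (auto elim: dvdE)
  have "x = of_int m * 2 powi (int d + Emin)"
    by (simp add: x k power_int_add)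
  moreover have "\<bar>m\<bar> < 2 ^ t"
    using d(3) by (simp add: k abs_mult power_add mult.commute)
  moreover have "int d + Emin \<le> Emax" using d(1) assms by linarith
  ultimately show "x \<in> dekker_floats 2 t Emin Emax"
    unfolding dekker_floats_def mem_Collect_eq
    by (intro exI[of _ m] exI[of _ "int d + Emin"]) simp
qed

text \<open>Multiplication by the positive number \<open>2 powi Emin\<close> preserves comparisons
  of distances, so \<open>fl\<close> can be replaced by \<open>is_nearest\<close> at multiples of
  that number.\<close>

lemma nearest_rounding_obtain_int:
  assumes "Emin \<le> Emax" "nearest_rounding (dekker_floats 2 t Emin Emax) fl"
    and "r = of_int s * 2 powi Emin"
  obtains a where "fl r = of_int a * 2 powi Emin"
    "is_nearest (int_floats t (nat (Emax - Emin))) s a"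
proof -
  let ?F = "int_floats t (nat (Emax - Emin))"
  have fl: "fl r \<in> (\<lambda>k. of_int k * 2 powi Emin) ` ?F"
    "\<And>b. b \<in> ?F \<Longrightarrow> \<bar>fl r - r\<bar> \<le> \<bar>of_int b * 2 powi Emin - r\<bar>"
    using assms(2) unfolding nearest_rounding_def dekker_floats_2_eq[OF assms(1)] by auto
  from fl(1) obtain a where a: "a \<in> ?F" "fl r = of_int a * 2 powi Emin" by auto
  have "\<bar>a - s\<bar> \<le> \<bar>b - s\<bar>" if "b \<in> ?F" for b
  proof -
    have "\<bar>of_int (a - s) * (2::real) powi Emin\<bar> \<le> \<bar>of_int (b - s) * 2 powi Emin\<bar>"
      using fl(2)[OF that] unfolding a(2) unfolding assms(3) by (simp add: left_diff_distrib)
    then have "\<bar>of_int (a - s) :: real\<bar> \<le> \<bar>of_int (b - s)\<bar>"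
      by (simp add: abs_mult del: of_int_diff)
    then show ?thesis by linarith
  qed
  with a show ?thesis by (intro that) (auto simp: is_nearest_def)
qed

theorem theorem3p2:
  fixes t :: nat and Emin Emax :: int and fl :: "real \<Rightarrow> real"
    and x y z w z1 v z2 zz :: real
  assumes "t \<ge> 1" and "Emin \<le> Emax"
    and "nearest_rounding (dekker_floats 2 t Emin Emax) fl"
    and "x \<in> dekker_floats 2 t Emin Emax" and "y \<in> dekker_floats 2 t Emin Emax"
    and "z = fl (x + y)"
    and "w = fl (z - x)"
    and "z1 = fl (y - w)"
    and "v = fl (w - z)"
    and "z2 = fl (x + v)"
    and "zz = fl (z1 + z2)"
  shows "z + zz = x + y"
proof -
  let ?F = "int_floats t (nat (Emax - Emin))"
  note obtain_int = nearest_rounding_obtain_int[OF assms(2,3)]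
  obtain X Y where X: "X \<in> ?F" "x = of_int X * 2 powi Emin"
    and Y: "Y \<in> ?F" "y = of_int Y * 2 powi Emin"
    using assms(4,5) by (auto simp: dekker_floats_2_eq[OF assms(2)])
  \<comment> \<open>Each rounded result is again a multiple of \<open>2 powi Emin\<close>, so the
    next operation can be transferred too.\<close>
  obtain Z where Z: "z = of_int Z * 2 powi Emin" "is_nearest ?F (X + Y) Z"
    using obtain_int[of "x + y" "X + Y"] assms(6) X Y by (auto simp: distrib_right)
  obtain W where W: "w = of_int W * 2 powi Emin" "is_nearest ?F (Z - X) W"
    using obtain_int[of "z - x" "Z - X"] assms(7) X Z by (auto simp: left_diff_distrib)
  obtain Z1 where Z1: "z1 = of_int Z1 * 2 powi Emin" "is_nearest ?F (Y - W) Z1"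
    using obtain_int[of "y - w" "Y - W"] assms(8) Y W by (auto simp: left_diff_distrib)
  obtain V where V: "v = of_int V * 2 powi Emin" "is_nearest ?F (W - Z) V"
    using obtain_int[of "w - z" "W - Z"] assms(9) W Z by (auto simp: left_diff_distrib)
  obtain Z2 where Z2: "z2 = of_int Z2 * 2 powi Emin" "is_nearest ?F (X + V) Z2"
    using obtain_int[of "x + v" "X + V"] assms(10) X V by (auto simp: distrib_right)
  obtain ZZ where ZZ: "zz = of_int ZZ * 2 powi Emin" "is_nearest ?F (Z1 + Z2) ZZ"
    using obtain_int[of "z1 + z2" "Z1 + Z2"] assms(11) Z1 Z2 by (auto simp: distrib_right)
  have "Z + ZZ = X + Y"
    using is_nearest_two_sum[OF assms(1) X(1) Y(1) Z(2) W(2) Z1(2) V(2) Z2(2) ZZ(2)] .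
  then have "of_int (Z + ZZ) * 2 powi Emin = (of_int (X + Y) * 2 powi Emin :: real)" by simp
  then show ?thesis using X Y Z ZZ by (simp add: distrib_right)
qed

end
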